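(* Let $(\underline P,\overline P)$ be a coherent Nearly-Linear model on $\mathcal A(\mathbb P)$ built from a probability $P_0$ and parameters $a,b,c$. Let $\mathcal B\subset\mathcal A(\mathbb P)\setminus\{\emptyset\}$ be a partition and let $A\in\mathcal A(\mathbb P)$ be non-extreme and logically independent of $\mathcal B$. For $B\in\mathcal B$ consider the following two conditions. (a) One of the following holds: (a1) $\underline P(A\wedge B)>0$, $\overline P(A^{\mathsf c}\wedge B)>0$ and $P_0(A\wedge B^{\mathsf c})\ge P_0(B^{\mathsf c})\,\underline P(A)$; or (a2) $\underline P(A\wedge B)=0$. (b) One of the following holds: (b1) $\underline P(A^{\mathsf c}\wedge B)>0$, $\overline P(A\wedge B)>0$ and $P_0(A\wedge B^{\mathsf c})\le P_0(B^{\mathsf c})\,\overline P(A)$; or (b2) $\underline P(A^{\mathsf c}\wedge B)=0$. Then: 1) For every $B\in\mathcal B$ with $\underline P(B)>0$, the inequalities $\underline E(A|B)\le\underline P(A)\le\overline P(A)\le\overline E(A|B)$ hold if and only if (a) and (b) both hold for $B$. 2) $\mathcal B$ weakly dilates $A$ if and only if (a) and (b) both hold for every $B\in\mathcal B$ such that $\underline P(B)>0$.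
   Context: Let $\mathbb P$ be a partition (finite or infinite) of the sure event $\Omega$ and $\mathcal A(\mathbb P)$ the set of events logically dependent on $\mathbb P$, i.e. (identifying events with sets) the power set of $\mathbb P$, with $\Omega$ the whole set, $\emptyset$ the impossible event, $\wedge,\vee,{}^{\mathsf c}$ intersection, union, complement, and $A\Rightarrow B$ meaning $A\subseteq B$. A partition $\mathcal B\subset\mathcal A(\mathbb P)\setminus\{\emptyset\}$ is a family of pairwise disjoint non-empty events whose union is $\Omega$. "Probability" means finitely additive probability on $\mathcal A(\mathbb P)$. Nearly-Linear (NL) model: given a probability $P_0$ on $\mathcal A(\mathbb P)$ and $b>0$, $a\in\mathbb R$, $c=1-(a+b)$, it is the couple $(\underline P,\overline P)$ with, for $A\in\mathcal A(\mathbb P)\setminus\{\emptyset,\Omega\}$, $\underline P(A)=\min\{\max\{bP_0(A)+a,0\},1\}$ and $\overline P(A)=\max\{\min\{bP_0(A)+c,1\},0\}$, and $\underline P(\emptyset)=\overline P(\emptyset)=0$, $\underline P(\Omega)=\overline P(\Omega)=1$. These are conjugate: $\overline P(A)=1-\underline P(A^{\mathsf c})$. The model is coherent if $\underline P$ is the pointwise infimum of some non-empty set of probabilities on $\mathcal A(\mathbb P)$. Natural extension: let $\mathcal M=\{P \text{ probability on }\mathcal A(\mathbb P): P\ge\underline P\}$ (the credal set). For $B\ne\emptyset$, let $\mathcal M_B$ be the set of pairs $(P,P(\cdot|B))$ with $P\in\mathcal M$ and $P(\cdot|B)$ a probability on $\mathcal A(\mathbb P)$ satisfying $P(B|B)=1$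 and $P(A\wedge B)=P(A|B)P(B)$ for all $A\in\mathcal A(\mathbb P)$. Then $\underline E(A|B)=\inf_{\mathcal M_B}P(A|B)$ and $\overline E(A|B)=\sup_{\mathcal M_B}P(A|B)$. $\mathcal B$ weakly dilates $A$ if $\underline E(A|B)\le\underline P(A)\le\overline P(A)\le\overline E(A|B)$ for all $B\in\mathcal B$. $A$ is logically independent of $\mathcal B$ if $B\not\Rightarrow A$ and $B\not\Rightarrow A^{\mathsf c}$ for all $B\in\mathcal B$. $A$ is extreme if $\underline P(A)=\overline P(A)=0$ or $\underline P(A)=\overline P(A)=1$. *)

theory Defs
  imports "HOL-Analysis.Analysis"
begin

(* The elements of the type 'a are the members of the partition generating the events;
   'a may be finite or infinite.  Events are the sets of type 'a set, the sure event
   is UNIV, the impossible event is {}. *)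

definition fa_prob :: "('a set \<Rightarrow> real) \<Rightarrow> bool" where
  "fa_prob P \<longleftrightarrow> (\<forall>A. 0 \<le> P A) \<and> P UNIV = 1 \<and> additive UNIV P"

definition nl_lower :: "('a set \<Rightarrow> real) \<Rightarrow> real \<Rightarrow> real \<Rightarrow> 'a set \<Rightarrow> real" where
  "nl_lower P0 a b A =
     (if A = {} then 0 else if A = UNIV then 1 else min (max (b * P0 A + a) 0) 1)"

(* The upper probability depends on the third parameter c = 1 - (a + b). *)
definition nl_upper :: "('a set \<Rightarrow> real) \<Rightarrow> real \<Rightarrow> real \<Rightarrow> 'a set \<Rightarrow> real" where
  "nl_upper P0 b c A =
     (if A = {} then 0 else if A = UNIV then 1 else max (min (b * P0 A + c) 1) 0)"

definition coherent :: "('a set \<Rightarrow> real) \<Rightarrow> bool" where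
  "coherent lp \<longleftrightarrow>
     (\<exists>S. S \<noteq> {} \<and> (\<forall>P\<in>S. fa_prob P) \<and> (\<forall>A. lp A = (INF P\<in>S. P A)))"

definition credal_set :: "('a set \<Rightarrow> real) \<Rightarrow> ('a set \<Rightarrow> real) set" where
  "credal_set lp = {P. fa_prob P \<and> (\<forall>A. lp A \<le> P A)}"

(* Pairs (P, Q) with Q a version of the conditional probability of P given B;
   when P B = 0, the second component is only required to give mass 1 to B. *)
definition cond_credal_set ::
  "('a set \<Rightarrow> real) \<Rightarrow> 'a set \<Rightarrow> (('a set \<Rightarrow> real) \<times> ('a set \<Rightarrow> real)) set" where
  "cond_credal_set lp B =
     {(P, Q). P \<in> credal_set lp \<and> fa_prob Q \<and> Q B = 1 \<and> (\<forall>A. P (A \<inter> B) = Q A * P B)}"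

(* The infimum and supremum are taken in the reals; for coherent lp and B nonempty
   the index set is nonempty and all values lie in [0, 1]. *)
definition lower_ext :: "('a set \<Rightarrow> real) \<Rightarrow> 'a set \<Rightarrow> 'a set \<Rightarrow> real" where
  "lower_ext lp A B = (INF (P, Q)\<in>cond_credal_set lp B. Q A)"

definition upper_ext :: "('a set \<Rightarrow> real) \<Rightarrow> 'a set \<Rightarrow> 'a set \<Rightarrow> real" where
  "upper_ext lp A B = (SUP (P, Q)\<in>cond_credal_set lp B. Q A)"

definition weakly_dilates ::
  "('a set \<Rightarrow> real) \<Rightarrow> ('a set \<Rightarrow> real) \<Rightarrow> 'a set set \<Rightarrow> 'a set \<Rightarrow> bool" where
  "weakly_dilates lp up \<B> A \<longleftrightarrow>
     (\<forall>B\<in>\<B>. lower_ext lp A B \<le> lp A \<and> lp A \<le> up A \<and> up A \<le> upper_ext lp A B)"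

definition logically_independent :: "'a set \<Rightarrow> 'a set set \<Rightarrow> bool" where
  "logically_independent A \<B> \<longleftrightarrow> (\<forall>B\<in>\<B>. \<not> B \<subseteq> A \<and> \<not> B \<subseteq> - A)"

definition extreme_event ::
  "('a set \<Rightarrow> real) \<Rightarrow> ('a set \<Rightarrow> real) \<Rightarrow> 'a set \<Rightarrow> bool" where
  "extreme_event lp up A \<longleftrightarrow> (lp A = 0 \<and> up A = 0) \<or> (lp A = 1 \<and> up A = 1)"

definition dilation_cond_a ::
  "('a set \<Rightarrow> real) \<Rightarrow> ('a set \<Rightarrow> real) \<Rightarrow> ('a set \<Rightarrow> real) \<Rightarrow> 'a set \<Rightarrow> 'a set \<Rightarrow> bool" where
  "dilation_cond_a P0 lp up A B \<longleftrightarrow>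
     (lp (A \<inter> B) > 0 \<and> up (- A \<inter> B) > 0 \<and> P0 (A \<inter> - B) \<ge> P0 (- B) * lp A)
     \<or> lp (A \<inter> B) = 0"

definition dilation_cond_b ::
  "('a set \<Rightarrow> real) \<Rightarrow> ('a set \<Rightarrow> real) \<Rightarrow> ('a set \<Rightarrow> real) \<Rightarrow> 'a set \<Rightarrow> 'a set \<Rightarrow> bool" where
  "dilation_cond_b P0 lp up A B \<longleftrightarrow>
     (lp (- A \<inter> B) > 0 \<and> up (A \<inter> B) > 0 \<and> P0 (A \<inter> - B) \<le> P0 (- B) * up A)
     \<or> lp (- A \<inter> B) = 0"

end

theory Submission
  imports Defs
begin

text \<open>Condition (b) for \<open>A\<close> is condition (a) for \<open>- A\<close>, so only the lower bound matters. The ratio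
  \<open>r = lp (A \<inter> B) / (lp (A \<inter> B) + up (- A \<inter> B))\<close> always bounds \<open>lower_ext lp A B\<close> from below, and
  \<open>r \<le> lp A\<close> simplifies to the inequality in (a1). The bound \<open>r\<close> is
  attained when \<open>a \<le> 0 \<le> c\<close>. Coherence rules out \<open>a > 0\<close> unless \<open>B\<close> is the sure event, and for
  \<open>c < 0\<close> it forces \<open>lp B = 1\<close> under (a1), where \<open>lower_ext lp A B \<le> lp (A \<inter> B) / lp B\<close> suffices.
  If \<open>lp B = 0\<close>, compactness of the credal set gives \<open>P B = 0\<close> for some member \<open>P\<close>, and the
  conditional probabilities given \<open>B\<close> are unconstrained.\<close>

section \<open>Finitely additive probabilities\<close>

lemma fa_prob_nonneg: "fa_prob P \<Longrightarrow> 0 \<le> P X"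
  by (simp add: fa_prob_def)

lemma fa_prob_UNIV: "fa_prob P \<Longrightarrow> P UNIV = 1"
  by (simp add: fa_prob_def)

lemma fa_prob_Un: "fa_prob P \<Longrightarrow> X \<inter> Y = {} \<Longrightarrow> P (X \<union> Y) = P X + P Y"
  by (simp add: fa_prob_def additive_def)

lemma fa_prob_split: "fa_prob P \<Longrightarrow> P Y = P (X \<inter> Y) + P (- X \<inter> Y)"
  using fa_prob_Un[of P "X \<inter> Y" "- X \<inter> Y"] by (simp add: Int_Un_distrib2[symmetric] inf_assoc Int_left_commute)

lemma fa_prob_Compl: "fa_prob P \<Longrightarrow> P (- X) = 1 - P X"
  using fa_prob_split[of P UNIV X] by (simp add: fa_prob_UNIV)

lemma fa_prob_empty: "fa_prob P \<Longrightarrow> P {} = 0"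
  using fa_prob_Compl[of P UNIV] by (simp add: fa_prob_UNIV)

lemma fa_prob_mono: "fa_prob P \<Longrightarrow> X \<subseteq> Y \<Longrightarrow> P X \<le> P Y"
  using fa_prob_split[of P Y X] fa_prob_nonneg[of P "- X \<inter> Y"] by (simp add: Int_absorb2)

lemma fa_prob_le_1: "fa_prob P \<Longrightarrow> P X \<le> 1"
  using fa_prob_mono[of P X UNIV] by (simp add: fa_prob_UNIV)

lemma fa_prob_indicator: "fa_prob (\<lambda>X. indicator X x)"
  by (auto simp: fa_prob_def additive_def indicator_def)

lemma fa_prob_condition:
  assumes "fa_prob P" "P B > 0"
  shows "fa_prob (\<lambda>X. P (X \<inter> B) / P B)"
  using assms fa_prob_Un[OF assms(1), of "_ \<inter> B" "_ \<inter> B"]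
  by (auto simp: fa_prob_def additive_def Int_Un_distrib2 add_divide_distrib[symmetric]
      disjoint_iff intro!: arg_cong2[where f = "(/)"])

section \<open>Compactness of the credal set and attainment of the lower envelope\<close>

text \<open>The cube \<open>?K\<close> is compact by Tychonoff. Each defining condition of the
  credal set involves only finitely many coordinates, so the set is closed in the product
  topology.\<close>

lemma compact_credal_set: "compact (credal_set lp)"
proof -
  let ?K = "PiE UNIV (\<lambda>_. {0..1}) :: ('a set \<Rightarrow> real) set"
  have "compactin (product_topology (\<lambda>_. euclidean) UNIV) ?K"
    unfolding compactin_PiE by simp
  then have K: "compact ?K"
    by (simp add: euclidean_product_topology)
  have "credal_set lp = {P. (\<forall>X. 0 \<le> P X) \<and> P UNIV = 1
      \<and> (\<forall>X Y. X \<inter> Y = {} \<longrightarrow> P (X \<union> Y) = P X + P Y) \<and> (\<forall>X. lp X \<le> P X)}"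
    by (auto simp: credal_set_def fa_prob_def additive_def)
  moreover have "closed \<dots>"
    by (intro closed_Collect_conj closed_Collect_all closed_Collect_imp open_Collect_const
        closed_Collect_le closed_Collect_eq continuous_intros continuous_on_product_coordinates)
  moreover have "credal_set lp \<subseteq> ?K"
    by (auto simp: credal_set_def fa_prob_nonneg fa_prob_le_1)
  ultimately have "closed (credal_set lp)" "credal_set lp \<subseteq> ?K"
    by simp_all
  then show ?thesis
    using compact_Int_closed[OF K, of "credal_set lp"] by (simp add: Int_absorb1)
qed

text \<open>The infimum over \<open>S\<close> need not be attained in \<open>S\<close>, but the
  evaluation at \<open>X\<close> is continuous on the compact credal set, which contains
  \<open>S\<close>. Its minimum there is at most \<open>lp X\<close>, while every member dominates
  \<open>lp\<close>.\<close>

lemma coherent_attained: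
  assumes "coherent lp"
  obtains P where "fa_prob P" "\<And>Y. lp Y \<le> P Y" "P X = lp X"
proof -
  obtain S where S: "S \<noteq> {}" "\<forall>P\<in>S. fa_prob P" "\<And>Y. lp Y = (INF P\<in>S. P Y)"
    using assms by (auto simp: coherent_def)
  have bdd: "bdd_below ((\<lambda>P. P Y) ` S)" for Y
    using S(2) by (auto intro!: bdd_belowI2[of _ 0] fa_prob_nonneg)
  have sub: "S \<subseteq> credal_set lp"
    using S(2) by (auto simp: credal_set_def S(3) intro!: cINF_lower bdd)
  have "continuous_on (credal_set lp) (\<lambda>P. P X)"
    by (rule continuous_on_subset[OF continuous_on_product_coordinates]) simp
  then obtain P where P: "P \<in> credal_set lp" "\<forall>P'\<in>credal_set lp. P X \<le> P' X"
    using continuous_attains_inf[OF compact_credal_set] sub S(1) by blast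
  have "P X \<le> lp X"
    unfolding S(3) using P(2) sub S(1) by (intro cINF_greatest) auto
  with P(1) that show ?thesis
    by (auto simp: credal_set_def order.antisym)
qed

section \<open>Bounds and conjugacy for conditional extensions\<close>

lemma lower_ext_le:
  assumes "(P, Q) \<in> cond_credal_set lp B"
  shows "lower_ext lp A B \<le> Q A"
proof -
  have "bdd_below ((\<lambda>(P, Q). Q A) ` cond_credal_set lp B)"
    by (auto simp: cond_credal_set_def intro!: bdd_belowI2[of _ 0] fa_prob_nonneg)
  from cINF_lower[OF this assms] show ?thesis
    by (simp add: lower_ext_def)
qed

lemma lower_ext_le_ratio:
  assumes "P \<in> credal_set lp" "P B > 0"
  shows "lower_ext lp A B \<le> P (A \<inter> B) / P B"
proof -
  have "(P, \<lambda>X. P (X \<inter> B) / P B) \<in> cond_credal_set lp B"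
    using assms fa_prob_condition[of P B] by (auto simp: cond_credal_set_def credal_set_def)
  from lower_ext_le[OF this] show ?thesis .
qed

text \<open>Since \<open>P B = 0\<close>, the product rule reads \<open>0 = 0\<close>, so the second
  component may be the point mass at any point of \<open>B\<close> outside \<open>A\<close>.\<close>

lemma lower_ext_nonpos:
  assumes "P \<in> credal_set lp" "P B = 0" "\<not> B \<subseteq> A"
  shows "lower_ext lp A B \<le> 0"
proof -
  obtain x where x: "x \<in> B" "x \<notin> A"
    using assms(3) by blast
  have "P (X \<inter> B) = 0" for X
    using assms fa_prob_mono[of P "X \<inter> B" B] fa_prob_nonneg[of P "X \<inter> B"]
    by (auto simp: credal_set_def)
  then have "(P, \<lambda>X. indicator X x) \<in> cond_credal_set lp B"
    using assms x by (auto simp: cond_credal_set_def fa_prob_indicator)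
  from lower_ext_le[OF this, of A] x show ?thesis by simp
qed

lemma cond_credal_set_nonempty:
  assumes "coherent lp" "B \<noteq> {}"
  shows "cond_credal_set lp B \<noteq> {}"
proof -
  obtain P where P: "fa_prob P" "\<And>Y. lp Y \<le> P Y"
    using coherent_attained[OF assms(1)] by metis
  obtain x where x: "x \<in> B" using assms(2) by blast
  show ?thesis
  proof (cases "P B = 0")
    case True
    then have "P (X \<inter> B) = 0" for X
      using fa_prob_mono[OF P(1), of "X \<inter> B" B] fa_prob_nonneg[OF P(1), of "X \<inter> B"] by simp
    with P True x have "(P, \<lambda>X. indicator X x) \<in> cond_credal_set lp B"
      by (auto simp: cond_credal_set_def credal_set_def fa_prob_indicator)
    then show ?thesis by blast
  next
    case False
    with fa_prob_nonneg[OF P(1), of B] have "P B > 0" by simp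
    with P fa_prob_condition[OF P(1)]
    have "(P, \<lambda>X. P (X \<inter> B) / P B) \<in> cond_credal_set lp B"
      by (auto simp: cond_credal_set_def credal_set_def)
    then show ?thesis by blast
  qed
qed

text \<open>Both extensions range over the same pairs, and \<open>Q (- A) = 1 - Q A\<close>
  exchanges infimum and supremum. This reduces every upper bound to a lower bound for
  \<open>- A\<close>.\<close>

lemma upper_ext_conjugate:
  assumes "coherent lp" "B \<noteq> {}"
  shows "upper_ext lp A B = 1 - lower_ext lp (- A) B"
proof (rule antisym)
  let ?C = "cond_credal_set lp B"
  have compl: "Q (- A) = 1 - Q A" if "(P, Q) \<in> ?C" for P Q
    using that by (auto simp: cond_credal_set_def fa_prob_Compl)
  have ne: "?C \<noteq> {}" by (rule cond_credal_set_nonempty[OF assms])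
  have bdd: "bdd_above ((\<lambda>(P, Q). Q A) ` ?C)"
    by (auto simp: cond_credal_set_def intro!: bdd_aboveI2[of _ _ 1] fa_prob_le_1)
  show "upper_ext lp A B \<le> 1 - lower_ext lp (- A) B"
    unfolding upper_ext_def
  proof (rule cSUP_least[OF ne], clarify)
    fix P Q assume "(P, Q) \<in> ?C"
    then show "Q A \<le> 1 - lower_ext lp (- A) B"
      using lower_ext_le[of P Q lp B "- A"] compl[of P Q] by simp
  qed
  have "1 - upper_ext lp A B \<le> lower_ext lp (- A) B"
    unfolding lower_ext_def
  proof (rule cINF_greatest[OF ne], clarify)
    fix P Q assume PQ: "(P, Q) \<in> ?C"
    then show "1 - upper_ext lp A B \<le> Q (- A)"
      using cSUP_upper[OF PQ bdd] compl[of P Q] by (simp add: upper_ext_def)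
  qed
  then show "1 - lower_ext lp (- A) B \<le> upper_ext lp A B" by simp
qed

section \<open>Coherent Nearly-Linear models\<close>

locale coherent_nearly_linear =
  fixes P0 lp up :: "'a set \<Rightarrow> real" and a b c :: real
  assumes P0: "fa_prob P0"
    and b_pos: "b > 0"
    and c_eq: "c = 1 - (a + b)"
    and lp_eq: "lp = nl_lower P0 a b"
    and up_eq: "up = nl_upper P0 b c"
    and coh: "coherent lp"
begin

lemma up_conjugate: "up X = 1 - lp (- X)"
proof -
  have "b * P0 (- X) = b - b * P0 X"
    by (simp add: fa_prob_Compl[OF P0] algebra_simps)
  then show ?thesis
    by (auto simp: lp_eq up_eq nl_lower_def nl_upper_def c_eq max_def min_def)
qed

lemma lp_nonneg: "0 \<le> lp X"
  by (auto simp: lp_eq nl_lower_def)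

lemma lp_le_1: "lp X \<le> 1"
  by (auto simp: lp_eq nl_lower_def)

lemma up_nonneg: "0 \<le> up X"
  using lp_le_1[of "- X"] by (simp add: up_conjugate)

lemma up_le_1: "up X \<le> 1"
  using lp_nonneg[of "- X"] by (simp add: up_conjugate)

lemma credal_le_up: "fa_prob P \<Longrightarrow> (\<And>Y. lp Y \<le> P Y) \<Longrightarrow> P X \<le> up X"
  using fa_prob_Compl[of P X] by (metis up_conjugate diff_mono order_refl diff_diff_eq2 add_diff_cancel_left')

lemma lp_le_up: "lp X \<le> up X"
  by (metis coherent_attained coh credal_le_up)

lemma lp_mono: "X \<subseteq> Y \<Longrightarrow> lp X \<le> lp Y"
  by (metis coherent_attained coh fa_prob_mono order_trans)

text \<open>The strict bounds exclude both truncations as well as the events \<open>{}\<close> and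
  \<open>UNIV\<close>.\<close>

lemma lp_formula: "0 < lp X \<Longrightarrow> lp X < 1 \<Longrightarrow> lp X = b * P0 X + a"
  by (auto simp: lp_eq nl_lower_def split: if_splits)

lemma up_formula: "0 < up X \<Longrightarrow> up X < 1 \<Longrightarrow> up X = b * P0 X + c"
  by (auto simp: up_eq nl_upper_def split: if_splits)

text \<open>Conditioning a member that attains \<open>lp\<close> at \<open>A \<inter> B\<close>
  gives this bound, because its mass on \<open>B\<close> is at least \<open>lp B\<close>. It is
  crude, but good enough when \<open>lp (A \<inter> B) = 0\<close> or
  \<open>lp B = 1\<close>.\<close>

lemma lower_ext_le_lp_ratio:
  assumes "lp B > 0"
  shows "lower_ext lp A B \<le> lp (A \<inter> B) / lp B"
proof -
  obtain P where P: "fa_prob P" "\<And>Y. lp Y \<le> P Y" "P (A \<inter> B) = lp (A \<inter> B)"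
    using coherent_attained[OF coh] by metis
  have pos: "P B > 0" using P(2)[of B] assms by simp
  have "lower_ext lp A B \<le> P (A \<inter> B) / P B"
    using P pos by (intro lower_ext_le_ratio) (auto simp: credal_set_def)
  also have "\<dots> \<le> lp (A \<inter> B) / lp B"
    using P(2)[of B] P(3) assms lp_nonneg[of "A \<inter> B"] by (auto intro!: frac_le)
  finally show ?thesis .
qed

text \<open>For \<open>a > 0\<close> the model would give \<open>lp (X \<union> Y) < lp X + lp Y\<close>; the third nonempty event
  \<open>- (X \<union> Y)\<close> keeps the truncation at 1 from interfering.\<close>

lemma a_nonpos:
  fixes X Y :: "'a set"
  assumes "X \<noteq> {}" "Y \<noteq> {}" "X \<inter> Y = {}" "X \<union> Y \<noteq> UNIV"
  shows "a \<le> 0"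
proof (rule ccontr)
  assume "\<not> a \<le> 0"
  then have pos: "lp Z > 0" if "Z \<noteq> {}" for Z
    using that b_pos fa_prob_nonneg[OF P0, of Z] by (auto simp: lp_eq nl_lower_def add_nonneg_pos)
  obtain P where P: "fa_prob P" "\<And>Y. lp Y \<le> P Y" "P (X \<union> Y) = lp (X \<union> Y)"
    using coherent_attained[OF coh] by metis
  have le: "lp X + lp Y \<le> lp (X \<union> Y)"
    using P(2)[of X] P(2)[of Y] P(3) fa_prob_Un[OF P(1) assms(3)] by simp
  have "- (X \<union> Y) \<noteq> {}" using assms(4) by blast
  then have "lp (X \<union> Y) < 1"
    using P(2)[of "- (X \<union> Y)"] P(3) fa_prob_Compl[OF P(1), of "X \<union> Y"] pos[of "- (X \<union> Y)"]
    by linarith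
  then show False
    using le lp_formula[of X] lp_formula[of Y] lp_formula[of "X \<union> Y"] pos[of X] pos[of Y] pos[of "X \<union> Y"]
      assms fa_prob_Un[OF P0 assms(3)] \<open>\<not> a \<le> 0\<close> by (auto simp: algebra_simps)
qed

text \<open>Coherence makes \<open>up\<close> subadditive. Without truncation at 1 the linear
  formula would give \<open>up (X \<union> Y) = up X + up Y - c\<close>, which is too large for
  \<open>c < 0\<close>.\<close>

lemma up_Un_eq_1:
  assumes "c < 0" "X \<inter> Y = {}" "up X > 0" "up Y > 0"
  shows "up (X \<union> Y) = 1"
proof (rule ccontr)
  assume "up (X \<union> Y) \<noteq> 1"
  with up_le_1[of "X \<union> Y"] have lt: "up (X \<union> Y) < 1" by simp
  obtain P where P: "fa_prob P" "\<And>Y. lp Y \<le> P Y" "P (- (X \<union> Y)) = lp (- (X \<union> Y))"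
    using coherent_attained[OF coh] by metis
  have sub: "up (X \<union> Y) \<le> up X + up Y"
    using P(3) fa_prob_Compl[OF P(1), of "X \<union> Y"] fa_prob_Un[OF P(1) assms(2)]
      credal_le_up[OF P(1,2), of X] credal_le_up[OF P(1,2), of Y] by (simp add: up_conjugate)
  have mono: "up X \<le> up (X \<union> Y)" "up Y \<le> up (X \<union> Y)"
    by (simp_all add: up_conjugate lp_mono)
  show False
    using sub mono lt assms up_formula[of X] up_formula[of Y] up_formula[of "X \<union> Y"]
      fa_prob_Un[OF P0 assms(2)] by (simp add: algebra_simps)
qed

text \<open>The mass \<open>a \<le> 0\<close> is removed proportionally from \<open>X\<close> and the mass \<open>c \<ge> 0\<close> is added at a point
  of \<open>Y\<close>, so that both bounds are attained by the same probability.\<close>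

lemma simultaneously_attained:
  assumes "a \<le> 0" "c \<ge> 0" "X \<inter> Y = {}" "0 < lp X" "lp X < 1" "0 < up Y" "up Y < 1"
  obtains P where "P \<in> credal_set lp" "P X = lp X" "P Y = up Y"
proof -
  have "Y \<noteq> {}" using assms(6) by (auto simp: up_eq nl_upper_def)
  then obtain r where r: "r \<in> Y" by blast
  have lpX: "lp X = b * P0 X + a" and upY: "up Y = b * P0 Y + c"
    using assms lp_formula up_formula by auto
  have p: "P0 X > 0"
    using assms(1,4) lpX b_pos by (metis add_nonpos_nonpos fa_prob_nonneg[OF P0] less_eq_real_def
        linorder_not_less mult_zero_right)
  define P where "P Z = b * P0 Z + a * (P0 (Z \<inter> X) / P0 X) + c * indicator Z r" for Z
  have cond: "fa_prob (\<lambda>Z. P0 (Z \<inter> X) / P0 X)"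
    by (rule fa_prob_condition[OF P0 p])
  have ge: "b * P0 Z + a \<le> P Z" for Z
  proof -
    have "a * 1 \<le> a * (P0 (Z \<inter> X) / P0 X)"
      by (rule mult_left_mono_neg[OF fa_prob_le_1[OF cond] assms(1)])
    moreover have "0 \<le> c * indicator Z r" using assms(2) by (simp add: indicator_def)
    ultimately show ?thesis unfolding P_def by linarith
  qed
  \<comment> \<open>On \<open>X\<close> the scaled measure with the proportional part removed is
    \<open>lp X / P0 X\<close> times \<open>P0\<close>, hence still nonnegative.\<close>
  have nonneg: "0 \<le> P Z" for Z
  proof -
    have "0 \<le> (b * P0 X + a) * (P0 (Z \<inter> X) / P0 X)"
      using assms(4) lpX fa_prob_nonneg[OF cond, of Z] by (metis less_eq_real_def mult_nonneg_nonneg)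
    also have "\<dots> = b * P0 (Z \<inter> X) + a * (P0 (Z \<inter> X) / P0 X)"
      using p by (simp add: field_simps)
    also have "\<dots> \<le> b * P0 Z + a * (P0 (Z \<inter> X) / P0 X)"
      using b_pos by (simp add: fa_prob_mono[OF P0])
    also have "\<dots> \<le> P Z" using assms(2) by (simp add: P_def)
    finally show ?thesis .
  qed
  have add: "P (V \<union> W) = P V + P W" if "V \<inter> W = {}" for V W
    using fa_prob_Un[OF P0 that] fa_prob_Un[OF cond that] fa_prob_Un[OF fa_prob_indicator[of r] that]
    unfolding P_def by (simp add: distrib_left)
  have one: "P UNIV = 1"
    using fa_prob_UNIV[OF P0] p by (simp add: P_def c_eq)
  have fa: "fa_prob P"
    using nonneg add one by (auto simp: fa_prob_def additive_def)
  have "lp Z \<le> P Z" for Z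
    using ge[of Z] nonneg[of Z] one by (auto simp: lp_eq nl_lower_def)
  with fa have "P \<in> credal_set lp" by (simp add: credal_set_def)
  moreover have "P X = lp X"
    using p r assms(3) by (auto simp: P_def lpX indicator_def)
  moreover have "P Y = up Y"
    using r assms(3) by (simp add: P_def upY fa_prob_empty[OF P0] Int_commute)
  ultimately show ?thesis by (rule that)
qed

section \<open>The optimal ratio and its comparison with the lower probability\<close>

text \<open>The parameters \<open>a\<close> and \<open>c\<close> cancel: the denominator
  \<open>lp (A \<inter> B) + up (- A \<inter> B)\<close> equals \<open>1 - b * P0 (- B)\<close>, and
  \<open>lp (A \<inter> B)\<close> equals \<open>lp A - b * P0 (A \<inter> - B)\<close>.\<close>

lemma ratio_le_lp_iff:
  assumes "0 < lp (A \<inter> B)" "lp A < 1" "0 < up (- A \<inter> B)"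
  shows "lp (A \<inter> B) \<le> lp A * (lp (A \<inter> B) + up (- A \<inter> B)) \<longleftrightarrow> P0 (- B) * lp A \<le> P0 (A \<inter> - B)"
proof -
  have le: "lp (A \<inter> B) \<le> lp A" by (rule lp_mono) simp
  have "lp (A \<inter> B) \<le> lp (- (- A \<inter> B))" by (rule lp_mono) auto
  then have "up (- A \<inter> B) < 1" using assms(1) by (simp add: up_conjugate)
  then have f: "lp (A \<inter> B) = b * P0 (A \<inter> B) + a" "lp A = b * P0 A + a"
      "up (- A \<inter> B) = b * P0 (- A \<inter> B) + c"
    using assms le lp_formula[of "A \<inter> B"] lp_formula[of A] up_formula by simp_all
  have p: "P0 A = P0 (A \<inter> B) + P0 (A \<inter> - B)" "P0 (- B) = P0 (A \<inter> - B) + P0 (- A \<inter> - B)"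
      "P0 (- A \<inter> B) + P0 (- A \<inter> - B) = 1 - P0 A"
    using fa_prob_split[OF P0, of A B] fa_prob_split[OF P0, of "- B" A]
      fa_prob_split[OF P0, of "- A" B] fa_prob_Compl[OF P0, of A]
    by (simp_all add: Int_commute)
  have l: "lp (A \<inter> B) = lp A - b * P0 (A \<inter> - B)"
    using f p(1) by (simp add: algebra_simps)
  \<comment> \<open>The difference \<open>P0 (- B) - P0 (A \<inter> - B)\<close> stands for
    \<open>P0 (- A \<inter> - B)\<close>, so that only the two \<open>P0\<close> values of the
    conclusion remain.\<close>
  have u: "up (- A \<inter> B) = 1 - lp A - b * (P0 (- B) - P0 (A \<inter> - B))"
  proof -
    have "P0 (- A \<inter> B) = 1 - P0 A - (P0 (- B) - P0 (A \<inter> - B))" using p(2,3) by simp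
    then show ?thesis by (simp only: f c_eq) (simp add: algebra_simps)
  qed
  have "lp A * (lp (A \<inter> B) + up (- A \<inter> B)) - lp (A \<inter> B) = b * (P0 (A \<inter> - B) - P0 (- B) * lp A)"
    unfolding l u by (simp add: algebra_simps)
  then have "lp (A \<inter> B) \<le> lp A * (lp (A \<inter> B) + up (- A \<inter> B))
      \<longleftrightarrow> 0 \<le> b * (P0 (A \<inter> - B) - P0 (- B) * lp A)" by linarith
  also have "\<dots> \<longleftrightarrow> P0 (- B) * lp A \<le> P0 (A \<inter> - B)"
    using b_pos by (simp add: zero_le_mult_iff)
  finally show ?thesis .
qed

text \<open>The product rule becomes
  \<open>(1 - Q A) * P (A \<inter> B) = Q A * P (- A \<inter> B)\<close>; bounding the left side
  below by \<open>lp\<close> and the right side above by \<open>up\<close> yields the ratio.\<close>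

lemma le_lower_ext:
  assumes "B \<noteq> {}" "0 < lp (A \<inter> B)"
  shows "lp (A \<inter> B) / (lp (A \<inter> B) + up (- A \<inter> B)) \<le> lower_ext lp A B"
  unfolding lower_ext_def
proof (rule cINF_greatest[OF cond_credal_set_nonempty[OF coh assms(1)]], clarify)
  fix P Q assume "(P, Q) \<in> cond_credal_set lp B"
  then have P: "fa_prob P" "\<And>Y. lp Y \<le> P Y" and Q: "fa_prob Q" and bayes: "P (A \<inter> B) = Q A * P B"
    by (auto simp: cond_credal_set_def credal_set_def)
  let ?l = "lp (A \<inter> B)" and ?u = "up (- A \<inter> B)"
  have "(1 - Q A) * ?l \<le> (1 - Q A) * P (A \<inter> B)"
    using P(2)[of "A \<inter> B"] fa_prob_le_1[OF Q, of A] by (intro mult_left_mono) auto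
  also have "\<dots> = Q A * P (- A \<inter> B)"
    using bayes fa_prob_split[OF P(1), of B A] by (simp add: algebra_simps)
  also have "\<dots> \<le> Q A * ?u"
    using credal_le_up[OF P] fa_prob_nonneg[OF Q] by (intro mult_left_mono) auto
  finally have "?l \<le> Q A * (?l + ?u)" by (simp add: algebra_simps)
  then show "?l / (?l + ?u) \<le> Q A"
    using assms(2) up_nonneg[of "- A \<inter> B"] by (simp add: pos_divide_le_eq)
qed

lemma lower_ext_le_lp:
  assumes B: "lp B > 0" and A: "lp A < 1" "\<not> B \<subseteq> A" "\<not> B \<subseteq> - A"
    and l: "0 < lp (A \<inter> B)" and u: "0 < up (- A \<inter> B)"
    and ineq: "P0 (- B) * lp A \<le> P0 (A \<inter> - B)"
  shows "lower_ext lp A B \<le> lp A"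
proof (cases "lp B = 1")
  case True
  have "lp (A \<inter> B) \<le> lp A" by (rule lp_mono) simp
  with True lower_ext_le_lp_ratio[OF B, of A] show ?thesis by simp
next
  case False
  then have "B \<noteq> UNIV" by (auto simp: lp_eq nl_lower_def)
  \<comment> \<open>The three disjoint nonempty events are \<open>A \<inter> B\<close>,
    \<open>- A \<inter> B\<close> and \<open>- B\<close>.\<close>
  then have a: "a \<le> 0"
    using A by (intro a_nonpos[of "A \<inter> B" "- A \<inter> B"]) blast+
  \<comment> \<open>A negative \<open>c\<close> would force upper probability 1 on the union of
    \<open>- A \<inter> B\<close> and \<open>- B\<close>, contradicting the positive lower
    probability of its complement \<open>A \<inter> B\<close>.\<close>
  have "- (- A \<inter> B \<union> - B) = A \<inter> B" by blast
  then have "up (- A \<inter> B \<union> - B) \<noteq> 1"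
    using l up_conjugate[of "- A \<inter> B \<union> - B"] by (simp del: Compl_Un)
  moreover have "up (- B) > 0"
    using False lp_le_1[of B] by (simp add: up_conjugate)
  ultimately have c: "c \<ge> 0"
    using up_Un_eq_1[of "- A \<inter> B" "- B"] u by fastforce
  have "lp (A \<inter> B) \<le> lp (- (- A \<inter> B))" by (rule lp_mono) auto
  then have u1: "up (- A \<inter> B) < 1" using l by (simp add: up_conjugate)
  have l1: "lp (A \<inter> B) < 1" using lp_mono[of "A \<inter> B" A] A(1) by simp
  obtain P where P: "P \<in> credal_set lp" "P (A \<inter> B) = lp (A \<inter> B)" "P (- A \<inter> B) = up (- A \<inter> B)"
    using simultaneously_attained[OF a c _ l l1 u u1] by blast
  have PB: "P B = lp (A \<inter> B) + up (- A \<inter> B)"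
    using P fa_prob_split[of P B A] by (simp add: credal_set_def)
  have "lower_ext lp A B \<le> P (A \<inter> B) / P B"
    using l u PB by (intro lower_ext_le_ratio[OF P(1)]) simp
  also have "\<dots> \<le> lp A"
    using ratio_le_lp_iff[OF l A(1) u] ineq l u by (simp add: PB P(2) pos_divide_le_eq)
  finally show ?thesis .
qed

section \<open>Dilation criteria\<close>

lemma lower_dilation_iff:
  assumes B: "lp B > 0" and A: "lp A < 1" "\<not> B \<subseteq> A" "\<not> B \<subseteq> - A"
  shows "lower_ext lp A B \<le> lp A \<longleftrightarrow> dilation_cond_a P0 lp up A B"
proof (cases "lp (A \<inter> B) = 0")
  case True
  then have "lower_ext lp A B \<le> lp A"
    using lower_ext_le_lp_ratio[OF B, of A] lp_nonneg[of A] by simp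
  with True show ?thesis by (simp add: dilation_cond_a_def)
next
  case False
  then have l: "0 < lp (A \<inter> B)" using lp_nonneg[of "A \<inter> B"] by simp
  have "0 < up (- A \<inter> B) \<and> P0 (- B) * lp A \<le> P0 (A \<inter> - B)" if E: "lower_ext lp A B \<le> lp A"
  proof -
    have "lp (A \<inter> B) / (lp (A \<inter> B) + up (- A \<inter> B)) \<le> lp A"
      using le_lower_ext[OF _ l] A(2) E by fastforce
    then have ratio: "lp (A \<inter> B) \<le> lp A * (lp (A \<inter> B) + up (- A \<inter> B))"
      using l up_nonneg[of "- A \<inter> B"] by (simp add: pos_divide_le_eq)
    \<comment> \<open>If this upper probability vanished, the ratio would be 1 and exceed
      \<open>lp A\<close>.\<close>
    have "up (- A \<inter> B) \<noteq> 0"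
    proof
      assume "up (- A \<inter> B) = 0"
      with ratio have "1 * lp (A \<inter> B) \<le> lp A * lp (A \<inter> B)" by simp
      with l A(1) show False by (simp only: mult_le_cancel_right) simp
    qed
    then have u: "0 < up (- A \<inter> B)" using up_nonneg[of "- A \<inter> B"] by simp
    with ratio_le_lp_iff[OF l A(1) u] ratio show ?thesis by simp
  qed
  with lower_ext_le_lp[OF B A l] l show ?thesis
    by (auto simp: dilation_cond_a_def)
qed

text \<open>Substituting \<open>up A = 1 - lp (- A)\<close> and
  \<open>P0 (A \<inter> - B) = P0 (- B) - P0 (- A \<inter> - B)\<close> reverses the
  inequality.\<close>

lemma dilation_cond_b_conjugate:
  "dilation_cond_b P0 lp up A B \<longleftrightarrow> dilation_cond_a P0 lp up (- A) B"
  using fa_prob_split[OF P0, of "- B" A]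
  by (simp add: dilation_cond_a_def dilation_cond_b_def up_conjugate[of A] algebra_simps)

lemma dilation_iff:
  assumes "lp B > 0" "\<not> extreme_event lp up A" "\<not> B \<subseteq> A" "\<not> B \<subseteq> - A"
  shows "lower_ext lp A B \<le> lp A \<and> lp A \<le> up A \<and> up A \<le> upper_ext lp A B
    \<longleftrightarrow> dilation_cond_a P0 lp up A B \<and> dilation_cond_b P0 lp up A B"
proof -
  \<comment> \<open>If \<open>lp A = 1\<close>, then \<open>up A = 1\<close>; if
    \<open>lp (- A) = 1\<close>, then \<open>up A = 0\<close> and so \<open>lp A = 0\<close>. Either
    way \<open>A\<close> would be extreme.\<close>
  have "lp A \<noteq> 1" "lp (- A) \<noteq> 1"
    using assms(2) lp_le_up[of A] up_le_1[of A] lp_nonneg[of A] up_conjugate[of A]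
    by (auto simp: extreme_event_def)
  then have lt: "lp A < 1" "lp (- A) < 1"
    using lp_le_1[of A] lp_le_1[of "- A"] by simp_all
  have "B \<noteq> {}" using assms(3) by blast
  then have "up A \<le> upper_ext lp A B \<longleftrightarrow> lower_ext lp (- A) B \<le> lp (- A)"
    by (simp add: upper_ext_conjugate[OF coh] up_conjugate)
  then show ?thesis
    using lower_dilation_iff[OF assms(1) lt(1)] lower_dilation_iff[OF assms(1) lt(2)] assms(3,4)
    by (simp add: dilation_cond_b_conjugate lp_le_up)
qed

text \<open>A member of the credal set vanishes on \<open>B\<close>, and \<open>B\<close> has points
  inside and outside \<open>A\<close>. Point masses there make the extension vacuous, with bounds 0
  and 1.\<close>

lemma dilation_of_lp_zero:
  assumes "lp B = 0" "\<not> B \<subseteq> A" "\<not> B \<subseteq> - A"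
  shows "lower_ext lp A B \<le> lp A \<and> lp A \<le> up A \<and> up A \<le> upper_ext lp A B"
proof -
  obtain P where "fa_prob P" "\<And>Y. lp Y \<le> P Y" "P B = lp B"
    using coherent_attained[OF coh] by metis
  then have "P \<in> credal_set lp" "P B = 0"
    using assms(1) by (auto simp: credal_set_def)
  then have "lower_ext lp A B \<le> 0" "lower_ext lp (- A) B \<le> 0"
    using assms(2,3) by (auto intro: lower_ext_nonpos)
  moreover have "upper_ext lp A B = 1 - lower_ext lp (- A) B"
    using upper_ext_conjugate[OF coh, of B A] assms(2) by auto
  ultimately show ?thesis
    using lp_nonneg[of A] up_le_1[of A] lp_le_up[of A] by simp
qed

end

theorem proposition4p1:
  fixes P0 lp up :: "'a set \<Rightarrow> real" and a b c :: real
    and \<B> :: "'a set set" and A :: "'a set"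
  assumes "fa_prob P0"
    and "b > 0"
    and "c = 1 - (a + b)"
    and "lp = nl_lower P0 a b"
    and "up = nl_upper P0 b c"
    and "coherent lp"
    and "partition_on UNIV \<B>"
    and "\<not> extreme_event lp up A"
    and "logically_independent A \<B>"
  shows "(\<forall>B\<in>\<B>. lp B > 0 \<longrightarrow>
            ((lower_ext lp A B \<le> lp A \<and> lp A \<le> up A \<and> up A \<le> upper_ext lp A B)
               \<longleftrightarrow> dilation_cond_a P0 lp up A B \<and> dilation_cond_b P0 lp up A B))
       \<and> (weakly_dilates lp up \<B> A \<longleftrightarrow>
            (\<forall>B\<in>\<B>. lp B > 0 \<longrightarrow>
               dilation_cond_a P0 lp up A B \<and> dilation_cond_b P0 lp up A B))"
proof -
  interpret coherent_nearly_linear P0 lp up a b c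
    using assms(1-6) by (rule coherent_nearly_linear.intro)
  have indep: "\<not> B \<subseteq> A" "\<not> B \<subseteq> - A" if "B \<in> \<B>" for B
    using assms(9) that by (auto simp: logically_independent_def)
  have pos: "(lower_ext lp A B \<le> lp A \<and> lp A \<le> up A \<and> up A \<le> upper_ext lp A B)
      \<longleftrightarrow> dilation_cond_a P0 lp up A B \<and> dilation_cond_b P0 lp up A B"
    if "B \<in> \<B>" "lp B > 0" for B
    using dilation_iff[OF that(2) assms(8) indep[OF that(1)]] .
  have zero: "lower_ext lp A B \<le> lp A \<and> lp A \<le> up A \<and> up A \<le> upper_ext lp A B"
    if "B \<in> \<B>" "\<not> lp B > 0" for B
    using dilation_of_lp_zero[OF _ indep[OF that(1)]] that(2) lp_nonneg[of B] by simp
  show ?thesis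
    unfolding weakly_dilates_def using pos zero by blast
qed

end
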